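(* Let $G$ be a graph of order $n$ with $n \geq 2$, and let $\overline{G}$ be its complement. Then $$4 \leq b_{\rm g}(G)\, b_{\rm g}(\overline{G}) \leq 2n.$$
   Context: All graphs are finite, simple and undirected; the order of a graph is its number of vertices. The burning game on a graph $G$ is played by two players, Burner and Staller, in rounds $t=1,2,3,\dots$. Initially (round $0$) all vertices are unburned. Each round $t\ge 1$ consists of two phases: first, in the spreading phase, every unburned vertex having a burning neighbor starts to burn (fire spreads simultaneously, by distance one, from all burning vertices); then, in the selection phase, if unburned vertices remain, the player whose turn it is chooses one unburned vertex, which starts to burn. Burning vertices stay burning forever. The players alternate: one of them selects in the odd rounds, the other in the even rounds. The game ends in the first round in which all vertices of $G$ are burning (possibly already after the spreading phase of that round). Burner wants to minimize the number of rounds and Staller wants to maximize it. If both play optimally, the number of rounds is denoted $b_{\rm g}(G)$ (the game burning number) when Burner makes the first move (selects in round 1). *)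

theory Defs
  imports "Graph_Theory.Pair_Digraph"
begin

text \<open>Finite simple undirected graphs are values of type \<open>'a pair_pre_digraph\<close> satisfying
  \<open>pair_graph\<close>: finite vertex set \<open>pverts G\<close> and a symmetric, irreflexive adjacency relation
  \<open>parcs G\<close> on it.\<close>

definition complement :: "'a pair_pre_digraph \<Rightarrow> 'a pair_pre_digraph" where
  "complement G = \<lparr> pverts = pverts G,
     parcs = {(u, v). u \<in> pverts G \<and> v \<in> pverts G \<and> u \<noteq> v \<and> (u, v) \<notin> parcs G} \<rparr>"

lemma pair_graph_complement:
  assumes "pair_graph G"
  shows "pair_graph (complement G)"
proof -
  interpret G: pair_graph G by fact
  have sym: "sym (parcs G)"
    using G.pair_sym_arcs by (simp add: symmetric_def)
  have "finite (parcs (complement G))"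
    by (rule finite_subset[of _ "pverts G \<times> pverts G"])
      (auto simp: complement_def G.pair_finite_verts)
  then show ?thesis
    using sym G.pair_finite_verts
    by unfold_locales (auto simp: complement_def symmetric_def sym_def)
qed

datatype player = Burner | Staller

fun opponent :: "player \<Rightarrow> player" where
  "opponent Burner = Staller"
| "opponent Staller = Burner"

definition spread :: "'a pair_pre_digraph \<Rightarrow> 'a set \<Rightarrow> 'a set" where
  "spread G B = B \<union> {v \<in> pverts G. \<exists>u\<in>B. (u, v) \<in> parcs G}"

text \<open>\<open>rounds_left G p B\<close> is the number of further rounds, under optimal play by both players,
  when \<open>B\<close> is the set of burning vertices at the end of the previous round and \<open>p\<close> is the
  player who selects in the coming round. The disjunct \<open>infinite (pverts G)\<close> only serves
  termination. Both \<open>Min\<close> and \<open>Max\<close> range over nonempty finite sets.\<close>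

function rounds_left :: "'a pair_pre_digraph \<Rightarrow> player \<Rightarrow> 'a set \<Rightarrow> nat" where
  "rounds_left G p B =
    (if infinite (pverts G) \<or> pverts G \<subseteq> B then 0
     else if pverts G \<subseteq> spread G B then 1
     else 1 + (case p of
         Burner \<Rightarrow> Min ((\<lambda>v. rounds_left G (opponent p) (insert v (spread G B)))
                     ` (pverts G - spread G B))
       | Staller \<Rightarrow> Max ((\<lambda>v. rounds_left G (opponent p) (insert v (spread G B)))
                     ` (pverts G - spread G B))))"
  by pat_completeness auto
termination
proof (relation "measure (\<lambda>(G, p, B). card (pverts G - B))", goal_cases)
  case 1
  show ?case by simp
next
  case (2 G p B v)
  then have "pverts G - insert v (spread G B) \<subset> pverts G - B" and "finite (pverts G - B)"
    by (auto simp: spread_def)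
  then show ?case by (simp only: in_measure case_prod_conv psubset_card_mono)
next
  case (3 G p B v)
  then have "pverts G - insert v (spread G B) \<subset> pverts G - B" and "finite (pverts G - B)"
    by (auto simp: spread_def)
  then show ?case by (simp only: in_measure case_prod_conv psubset_card_mono)
qed

declare rounds_left.simps [simp del]

definition game_burning_number :: "'a pair_pre_digraph \<Rightarrow> nat" where
  "game_burning_number G = rounds_left G Burner {}"

end

theory Submission
  imports Defs
begin

text \<open>If \<open>G\<close> has a vertex of degree at most 1, Burner opens with it in the complement, where at most
  one vertex survives the next spreading phase; so the complement takes at most 2 rounds, while
  \<open>G\<close> takes at most \<open>n\<close>. The same holds with the roles exchanged. Otherwise all degrees in both
  graphs are at least 2. Then, however the players move, a round without spreading is followed by a
  round that burns two vertices by spreading, so that rounds burn two vertices on average and either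
  game takes at most \<open>(n + 1) / 2\<close> rounds. Moreover, if two vertices have distance at least 3 in
  \<open>G\<close>, each of them has eccentricity at most 2 in the complement, so one of the two games takes at
  most 3 rounds, and \<open>3 (n + 1) / 2 \<le> 2 n\<close>.\<close>

section \<open>Complements and symmetry of adjacency\<close>

lemma complement_complement:
  assumes "pair_graph G"
  shows "complement (complement G) = G"
proof -
  interpret pair_graph G by fact
  show ?thesis
    by (rule pair_pre_digraph.equality)
      (auto simp: complement_def dest: arc_fst_in_verts arc_snd_in_verts no_loops)
qed

lemma pverts_complement [simp]: "pverts (complement G) = pverts G"
  by (simp add: complement_def)

lemma pair_graph_sym:
  assumes "pair_graph G" "(u, v) \<in> parcs G"
  shows "(v, u) \<in> parcs G"
proof -
  interpret pair_graph G by fact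
  show ?thesis using pair_sym_arcs assms(2) by (auto simp: symmetric_def dest: symD)
qed

section \<open>Elementary bounds on the value of a position\<close>

lemma rounds_left_finished: "pverts G \<subseteq> B \<Longrightarrow> rounds_left G p B = 0"
  by (simp add: rounds_left.simps)

lemma rounds_left_spread: "pverts G \<subseteq> spread G B \<Longrightarrow> rounds_left G p B \<le> 1"
  by (simp add: rounds_left.simps)

text \<open>Both \<open>Min\<close> and \<open>Max\<close> are attained, so a bound that survives
  every move can be proved for both players at once.\<close>

lemma rounds_left_some_move:
  assumes "finite (pverts G)" "\<not> pverts G \<subseteq> spread G B"
  obtains v where "v \<in> pverts G - spread G B"
    "rounds_left G p B = 1 + rounds_left G (opponent p) (insert v (spread G B))"
proof -
  let ?f = "\<lambda>v. rounds_left G (opponent p) (insert v (spread G B))"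
  let ?S = "?f ` (pverts G - spread G B)"
  have S: "finite ?S" "?S \<noteq> {}" using assms by auto
  have "\<not> pverts G \<subseteq> B" using assms(2) by (auto simp: spread_def)
  then have eq: "rounds_left G p B = 1 + (case p of Burner \<Rightarrow> Min ?S | Staller \<Rightarrow> Max ?S)"
    using assms by (subst rounds_left.simps) simp
  have "(case p of Burner \<Rightarrow> Min ?S | Staller \<Rightarrow> Max ?S) \<in> ?S"
    using Min_in[OF S] Max_in[OF S] by (cases p) simp_all
  then obtain v where "v \<in> pverts G - spread G B"
    "(case p of Burner \<Rightarrow> Min ?S | Staller \<Rightarrow> Max ?S) = ?f v"
    by (rule imageE)
  with eq show thesis using that by simp
qed

lemma rounds_left_Burner_le:
  assumes "finite (pverts G)" "v \<in> pverts G - spread G B"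
  shows "rounds_left G Burner B \<le> 1 + rounds_left G Staller (insert v (spread G B))"
proof -
  have "\<not> pverts G \<subseteq> B" "\<not> pverts G \<subseteq> spread G B"
    using assms(2) by (auto simp: spread_def)
  with assms show ?thesis
    by (subst rounds_left.simps) (auto intro!: Min_le)
qed

lemma rounds_left_le_one:
  assumes "finite (pverts G)" "card (pverts G - spread G B) \<le> 1"
  shows "rounds_left G p B \<le> 1"
proof (cases "pverts G \<subseteq> spread G B")
  case True
  then show ?thesis by (rule rounds_left_spread)
next
  case False
  then obtain v where v: "v \<in> pverts G - spread G B"
    "rounds_left G p B = 1 + rounds_left G (opponent p) (insert v (spread G B))"
    using rounds_left_some_move assms(1) by blast
  have "pverts G \<subseteq> insert v (spread G B)"
    using assms v(1) card_le_Suc0_iff_eq[of "pverts G - spread G B"] by auto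
  with v(2) show ?thesis by (simp add: rounds_left_finished)
qed

text \<open>Each round that starts with an unburned vertex burns at least one, by spreading or by
  selection.\<close>

lemma rounds_left_le_card:
  assumes "finite (pverts G)"
  shows "rounds_left G p B \<le> card (pverts G - B)"
proof (induction "card (pverts G - B)" arbitrary: p B rule: less_induct)
  case less
  show ?case
  proof (cases "pverts G \<subseteq> spread G B")
    case True
    show ?thesis
    proof (cases "pverts G \<subseteq> B")
      case False
      then have "card (pverts G - B) \<noteq> 0" using assms by auto
      with rounds_left_spread[OF True, of p] show ?thesis by linarith
    qed (simp add: rounds_left_finished)
  next
    case False
    then obtain v where v: "v \<in> pverts G - spread G B"
      "rounds_left G p B = 1 + rounds_left G (opponent p) (insert v (spread G B))"
      using rounds_left_some_move[OF assms] by blast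
    have "card (pverts G - insert v (spread G B)) < card (pverts G - B)"
      using v(1) assms by (intro psubset_card_mono) (auto simp: spread_def)
    with less[OF this, of "opponent p"] v(2) show ?thesis by linarith
  qed
qed

section \<open>Graphs of minimum degree at least two\<close>

text \<open>The second conjunct strengthens the induction hypothesis: it pays for a preceding round in
  which nothing was burned by spreading.\<close>

lemma rounds_left_min_degree_two_aux:
  assumes G: "pair_graph G"
    and deg: "\<And>v. v \<in> pverts G \<Longrightarrow> 2 \<le> card {u. (v, u) \<in> parcs G}"
  shows "2 * rounds_left G p B \<le> card (pverts G - B) + 1 \<and>
    (2 \<le> card (pverts G \<inter> spread G B - B) \<longrightarrow> 2 * rounds_left G p B \<le> card (pverts G - B))"
proof (induction "card (pverts G - B)" arbitrary: p B rule: less_induct)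
  case less
  interpret pair_graph G by fact
  let ?V = "pverts G"
  let ?S = "?V \<inter> spread G B - B"
  consider "?V \<subseteq> B" | "\<not> ?V \<subseteq> B" "?V \<subseteq> spread G B" | "\<not> ?V \<subseteq> spread G B" by blast
  then show ?case
  proof cases
    case 1
    then show ?thesis by (simp add: rounds_left_finished)
  next
    case 2
    have "card ?S \<le> card (?V - B)" by (intro card_mono) auto
    moreover have "card (?V - B) \<noteq> 0" using 2(1) by auto
    ultimately show ?thesis using rounds_left_spread[OF 2(2), of p] by linarith
  next
    case 3
    then obtain v where v: "v \<in> ?V - spread G B"
      and R: "rounds_left G p B = 1 + rounds_left G (opponent p) (insert v (spread G B))"
      using rounds_left_some_move[OF pair_finite_verts] by blast
    let ?B = "insert v (spread G B)"
    have sub: "B \<subseteq> spread G B" by (simp add: spread_def)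
    have "?V - B = insert v (?S \<union> (?V - ?B))" using v sub by auto
    moreover have "card (insert v (?S \<union> (?V - ?B))) = Suc (card (?S \<union> (?V - ?B)))"
      using v by (intro card_insert_disjoint) auto
    moreover have "card (?S \<union> (?V - ?B)) = card ?S + card (?V - ?B)"
      by (intro card_Un_disjoint) auto
    \<comment> \<open>The round burns the selected vertex \<open>v\<close> and the vertices in
      \<open>?S\<close>, reached by spreading.\<close>
    ultimately have c: "card (?V - B) = 1 + card ?S + card (?V - ?B)" by simp
    note IH = less[of ?B "opponent p"]
    show ?thesis
    proof (cases "card ?S = 0")
      case True
      then have empty: "?S = {}" by simp
      \<comment> \<open>No neighbor of \<open>v\<close> is in \<open>B\<close>, since
        \<open>v\<close> escaped the spreading, and none has just caught fire, since
        \<open>?S\<close> is empty. So all of them, except those already burned by no one, ignite in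
        the next spreading phase, and the second conjunct of \<open>IH\<close> applies.\<close>
      have "{u. (v, u) \<in> parcs G} \<subseteq> ?V \<inter> spread G ?B - ?B"
      proof
        fix u
        assume "u \<in> {u. (v, u) \<in> parcs G}"
        then have a: "(v, u) \<in> parcs G" by simp
        then have u: "u \<in> ?V" "u \<noteq> v" by (auto dest: arc_snd_in_verts no_loops)
        then have "u \<in> spread G ?B" using a by (auto simp: spread_def)
        moreover have "u \<notin> B"
          using pair_graph_sym[OF G a] v by (auto simp: spread_def)
        ultimately show "u \<in> ?V \<inter> spread G ?B - ?B" using u empty by auto
      qed
      then have "card {u. (v, u) \<in> parcs G} \<le> card (?V \<inter> spread G ?B - ?B)"
        by (intro card_mono) auto
      with deg[of v] v have "2 \<le> card (?V \<inter> spread G ?B - ?B)" by simp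
      with IH c R True show ?thesis unfolding True by simp
    next
      case False
      moreover have "2 * rounds_left G (opponent p) ?B \<le> card (?V - ?B) + 1"
        \<comment> \<open>The round costs 2 on the left and burns \<open>1 + card ?S\<close>
          vertices. With \<open>card ?S = 1\<close> the surplus 1 persists; with
          \<open>card ?S\<close> at least 2 it is paid off.\<close>
        using IH c by simp
      ultimately show ?thesis using c R by (intro conjI impI) linarith+
    qed
  qed
qed

section \<open>Bounds for the game from its initial position\<close>

lemma game_burning_number_le_card:
  assumes "finite (pverts G)"
  shows "game_burning_number G \<le> card (pverts G)"
  using rounds_left_le_card[OF assms, of Burner "{}"] by (simp add: game_burning_number_def)

lemma game_burning_number_min_degree_two:
  assumes "pair_graph G" "\<And>v. v \<in> pverts G \<Longrightarrow> 2 \<le> card {u. (v, u) \<in> parcs G}"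
  shows "2 * game_burning_number G \<le> card (pverts G) + 1"
  using rounds_left_min_degree_two_aux[OF assms, of Burner "{}"]
  by (simp add: game_burning_number_def)

lemma game_burning_number_le_first_move:
  assumes "finite (pverts G)" "v \<in> pverts G"
  shows "game_burning_number G \<le> 1 + rounds_left G Staller {v}"
  using rounds_left_Burner_le[of G v "{}"] assms
  by (simp add: game_burning_number_def spread_def)

text \<open>Nothing spreads in round 1, so exactly one vertex burns after it.\<close>

lemma game_burning_number_ge_two:
  assumes "finite (pverts G)" "2 \<le> card (pverts G)"
  shows "2 \<le> game_burning_number G"
proof -
  have "\<not> pverts G \<subseteq> spread G {}" using assms by (auto simp: spread_def)
  then obtain v where
    R: "rounds_left G Burner {} = 1 + rounds_left G Staller (insert v (spread G {}))"
    using rounds_left_some_move[OF assms(1), of "{}" Burner] by auto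
  have "\<not> pverts G \<subseteq> {v}"
    using assms card_mono[of "{v}" "pverts G"] by auto
  then have "rounds_left G Staller {v} \<noteq> 0"
    using assms(1) by (subst rounds_left.simps) simp
  with R show ?thesis by (simp add: game_burning_number_def spread_def)
qed

lemma game_burning_number_complement_le_two:
  assumes "pair_graph G" "v \<in> pverts G" "card {u. (v, u) \<in> parcs G} \<le> 1"
  shows "game_burning_number (complement G) \<le> 2"
proof -
  interpret pair_graph G by fact
  \<comment> \<open>In the complement, fire from \<open>v\<close> misses only the neighbors of
    \<open>v\<close> in \<open>G\<close>.\<close>
  have "pverts G - spread (complement G) {v} \<subseteq> {u. (v, u) \<in> parcs G}"
    using assms(2) by (auto simp: spread_def complement_def)
  moreover have "finite {u. (v, u) \<in> parcs G}"
    by (rule finite_subset[of _ "pverts G"]) (auto dest: arc_snd_in_verts)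
  ultimately have "card (pverts G - spread (complement G) {v}) \<le> 1"
    using assms(3) card_mono le_trans by blast
  then have "rounds_left (complement G) Staller {v} \<le> 1"
    by (intro rounds_left_le_one) auto
  with game_burning_number_le_first_move[of "complement G" v] assms(2) show ?thesis by simp
qed

text \<open>Burner opens with \<open>v\<close>. Spreading is monotone, so Staller's selection cannot
  stop the fire from covering everything in the spreading phase of round 3.\<close>

lemma game_burning_number_le_three:
  assumes fin: "finite (pverts G)" and v: "v \<in> pverts G"
    and ecc: "pverts G \<subseteq> spread G (spread G {v})"
  shows "game_burning_number G \<le> 3"
proof -
  have "rounds_left G Staller {v} \<le> 2"
  proof (cases "pverts G \<subseteq> spread G {v}")
    case True
    from rounds_left_spread[OF this, of Staller] show ?thesis by simp
  next
    case False
    then obtain s where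
      R: "rounds_left G Staller {v} = 1 + rounds_left G Burner (insert s (spread G {v}))"
      using rounds_left_some_move[OF fin, of "{v}" Staller] by auto
    have "pverts G \<subseteq> spread G (insert s (spread G {v}))"
      using ecc by (auto simp: spread_def)
    from rounds_left_spread[OF this, of Burner] R show ?thesis by simp
  qed
  with game_burning_number_le_first_move[OF fin v] show ?thesis by simp
qed

lemma game_burning_number_le_three_or_complement:
  assumes G: "pair_graph G" and ne: "pverts G \<noteq> {}"
  shows "game_burning_number G \<le> 3 \<or> game_burning_number (complement G) \<le> 3"
proof -
  interpret pair_graph G by fact
  show ?thesis
  proof (cases "\<exists>v\<in>pverts G. \<exists>w\<in>pverts G. w \<notin> spread G (spread G {v})")
    case False
    moreover obtain v where "v \<in> pverts G" using ne by blast
    ultimately have "game_burning_number G \<le> 3"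
      by (intro game_burning_number_le_three[of _ v]) auto
    then show ?thesis ..
  next
    case True
    then obtain v w where vw: "v \<in> pverts G" "w \<in> pverts G" "w \<notin> spread G (spread G {v})"
      by blast
    have "pverts G \<subseteq> spread (complement G) (spread (complement G) {v})"
    proof
      fix x
      assume x: "x \<in> pverts G"
      have w: "w \<in> spread (complement G) {v}"
        using vw by (auto simp: spread_def complement_def)
      show "x \<in> spread (complement G) (spread (complement G) {v})"
      proof (cases "(v, x) \<in> parcs G")
        case True
        \<comment> \<open>If \<open>w\<close> were equal or adjacent to \<open>x\<close> in
          \<open>G\<close>, it would be within distance 2 of \<open>v\<close>. Hence the complement
          has the path from \<open>v\<close> through \<open>w\<close> to \<open>x\<close>.\<close>
        then have "(w, x) \<in> parcs (complement G)"
          using vw x pair_graph_sym[OF G, of w x] by (auto simp: spread_def complement_def)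
        with w x show ?thesis by (auto simp: spread_def)
      next
        case False
        with x vw show ?thesis by (auto simp: spread_def complement_def)
      qed
    qed
    then have "game_burning_number (complement G) \<le> 3"
      using vw(1) by (intro game_burning_number_le_three[of _ v]) auto
    then show ?thesis ..
  qed
qed

theorem theorem9:
  fixes G :: "'a pair_pre_digraph" and n :: nat
  assumes "pair_graph G"
    and "card (pverts G) = n"
    and "n \<ge> 2"
  shows "4 \<le> game_burning_number G * game_burning_number (complement G)
       \<and> game_burning_number G * game_burning_number (complement G) \<le> 2 * n"
proof
  interpret pair_graph G by fact
  let ?H = "complement G"
  let ?b = "game_burning_number G" and ?c = "game_burning_number ?H"
  note H = pair_graph_complement[OF assms(1)]
  have "2 * 2 \<le> ?b * ?c"
    using assms by (intro mult_le_mono game_burning_number_ge_two) auto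
  then show "4 \<le> ?b * ?c" by simp
  have n: "?b \<le> n" "?c \<le> n"
    using game_burning_number_le_card[of G] game_burning_number_le_card[of ?H] assms(2) by auto
  consider v where "v \<in> pverts G" "card {u. (v, u) \<in> parcs G} \<le> 1"
    | v where "v \<in> pverts ?H" "card {u. (v, u) \<in> parcs ?H} \<le> 1"
    | "\<And>v. v \<in> pverts G \<Longrightarrow> 2 \<le> card {u. (v, u) \<in> parcs G}"
      "\<And>v. v \<in> pverts ?H \<Longrightarrow> 2 \<le> card {u. (v, u) \<in> parcs ?H}"
    by (metis Suc_1 not_less_eq_eq One_nat_def)
  then show "?b * ?c \<le> 2 * n"
  proof cases
    case 1
    from game_burning_number_complement_le_two[OF assms(1) 1] n(1)
    have "?b * ?c \<le> n * 2" by (intro mult_le_mono)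
    then show ?thesis by simp
  next
    case 2
    from game_burning_number_complement_le_two[OF H 2] n(2)
    show ?thesis
      using complement_complement[OF assms(1)] by (intro mult_le_mono) simp_all
  next
    case 3
    have le: "2 * ?b \<le> n + 1" "2 * ?c \<le> n + 1"
      using game_burning_number_min_degree_two[OF assms(1) 3(1)]
        game_burning_number_min_degree_two[OF H 3(2)] assms(2) by simp_all
    obtain v where v: "v \<in> pverts G" using assms by fastforce
    have "{u. (v, u) \<in> parcs G} \<subseteq> pverts G - {v}"
      by (auto dest: arc_snd_in_verts no_loops)
    then have "card {u. (v, u) \<in> parcs G} \<le> card (pverts G - {v})"
      by (intro card_mono) auto
    \<comment> \<open>A vertex and two neighbors give \<open>3 \<le> n\<close>, which is what
      \<open>3 * (n + 1) \<le> 4 * n\<close> requires.\<close>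
    with 3(1)[OF v] v assms(2) have n3: "3 \<le> n" by simp
    have "?b \<le> 3 \<or> ?c \<le> 3"
      using game_burning_number_le_three_or_complement[OF assms(1)] v by blast
    then have "2 * (?b * ?c) \<le> 3 * (n + 1)"
    proof
      assume "?b \<le> 3"
      from mult_le_mono[OF this le(2)] show ?thesis by (simp add: algebra_simps)
    next
      assume "?c \<le> 3"
      from mult_le_mono[OF this le(1)] show ?thesis by (simp add: algebra_simps)
    qed
    with n3 show ?thesis by simp
  qed
qed

end
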